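(* Let $p,q$ be relatively prime positive integers. Let $a_1,\dots,a_n\ge 0$ be the terms of a non-negative integer continued fraction expansion $$\frac qp=a_1+\cfrac{1}{a_2+\cfrac{1}{\cdots+\cfrac{1}{a_n}}}.$$ Then $$I(T_{p,q})=-\frac13\Big(pq-\sum_{i=1}^n a_i\Big).$$
   Context: $T_{p,q}$ is the (right-handed) $(p,q)$-torus knot. For a knot $K\subset S^3$, $I(K)=\int_0^2\Upsilon_K(t)\,dt$, where $\Upsilon_K:[0,2]\to\mathbb R$ is the Ozsváth–Stipsicz–Szabó Upsilon invariant: for $t\in[0,2]$ consider on $CFK^\infty(S^3,K)$ the filtration $\mathcal F_t=\frac t2\,\mathrm{Alex}+(1-\frac t2)\,\mathrm{Alg}$, and let $\Upsilon_K(t)=-2\nu$ where $\nu$ is the least filtration level whose subcomplex contains a cycle representing the generator of the grading-$0$ homology of $CFK^\infty(S^3,K)$. For $K=T_{p,q}$ this is equivalently (Borodzik–Livingston) $$\Upsilon_{T_{p,q}}(t)=\max_{m\in\{0,\dots,2g\}}\{-2\#(S\cap[0,m))-t(g-m)\},$$ with $g=(p-1)(q-1)/2$ and $S=\{pa+qb: a,b\in\mathbb Z_{\ge0}\}$. *)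

theory Defs
  imports "HOL-Analysis.Analysis"
begin

definition torus_semigroup :: "nat \<Rightarrow> nat \<Rightarrow> nat set" where
  "torus_semigroup p q = {p * a + q * b | a b. True}"

text \<open>The division by 2 is exact for coprime parameters, see \<open>twice_torus_genus\<close>.\<close>

definition torus_genus :: "nat \<Rightarrow> nat \<Rightarrow> nat" where
  "torus_genus p q = (p - 1) * (q - 1) div 2"

lemma twice_torus_genus:
  assumes "coprime p q"
  shows "2 * torus_genus p q = (p - 1) * (q - 1)"
proof -
  have "odd p \<or> odd q"
    using assms by (metis coprime_common_divisor_nat even_numeral odd_one numeral_eq_one_iff
        semiring_norm(85))
  then show ?thesis
    by (auto simp: torus_genus_def)
qed

text \<open>The Upsilon function of the right-handed torus knot with coprime positive parameters
  \<open>p\<close> and \<open>q\<close>, for \<open>0 \<le> t \<le> 2\<close>.  It is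
  defined by the formula of Borodzik and Livingston, which counts elements of the semigroup
  generated by \<open>p\<close> and \<open>q\<close>; its agreement with the definition by filtration levels on the
  full knot Floer complex is not formalised.\<close>

definition torus_upsilon :: "nat \<Rightarrow> nat \<Rightarrow> real \<Rightarrow> real" where
  "torus_upsilon p q t =
     (MAX m\<in>{0..2 * torus_genus p q}.
        - 2 * real (card (torus_semigroup p q \<inter> {0..<m}))
        - t * (real (torus_genus p q) - real m))"

definition torus_upsilon_integral :: "nat \<Rightarrow> nat \<Rightarrow> real" where
  "torus_upsilon_integral p q = integral {0..2} (torus_upsilon p q)"

text \<open>\<open>cf_expansion [a\<^sub>1, \<dots>, a\<^sub>n] x\<close> says that \<open>a\<^sub>1 + 1/(a\<^sub>2 + 1/(\<dots> + 1/a\<^sub>n))\<close> is a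
  well-defined expression with value \<open>x\<close>.  The terms may be zero in any position, as long as
  no division by zero occurs; an empty expansion is excluded.\<close>

inductive cf_expansion :: "nat list \<Rightarrow> real \<Rightarrow> bool" where
  single: "cf_expansion [a] (real a)"
| step: "cf_expansion as x \<Longrightarrow> x \<noteq> 0 \<Longrightarrow> cf_expansion (a # as) (real a + 1 / x)"

end

theory Submission
  imports Defs "HOL-Number_Theory.Cong"
begin

text \<open>The integral is computed through the Feller--Krcatovich recursion: adding a full twist on
  \<open>p\<close> strands changes \<open>\<Upsilon>\<close> by a function depending only on \<open>p\<close>, whose integral is
  \<open>-(p\<^sup>2 - 1)/3\<close>.  Together with the symmetry in \<open>p\<close> and \<open>q\<close> this follows the Euclidean
  algorithm, that is, the continued fraction.  For the recursion, split the semigroup into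
  residue classes modulo \<open>p\<close>: the number of elements below \<open>m\<close> is the sum over \<open>b < p\<close> of
  \<open>max 0 n\<^sub>b\<close> with \<open>n\<^sub>b = \<lceil>(m - q b)/p\<rceil>\<close>.  Replacing \<open>(q, m)\<close> by \<open>(q + p, m + p k)\<close> replaces
  \<open>n\<^sub>b\<close> by \<open>n\<^sub>b + (k - b)\<close>, so subadditivity of \<open>max 0\<close> gives one inequality; it is an equality
  when \<open>n\<^sub>b\<close> and \<open>k - b\<close> never have opposite signs, and every \<open>m + p k\<close> can be written with
  such a \<open>k\<close>.\<close>

section \<open>Semigroup counts and the full-twist function\<close>

text \<open>Adding \<open>int p - 1\<close> turns the floor of \<open>div\<close> into a ceiling.
  The argument is an integer so that multiples of \<open>p\<close> can be subtracted freely.\<close>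

definition semigroup_count :: "nat \<Rightarrow> nat \<Rightarrow> int \<Rightarrow> int" where
  "semigroup_count p q m =
     (\<Sum>b<p. max 0 ((m - int q * int b + int p - 1) div int p))"

text \<open>For \<open>p > 0\<close> this is, on [0,2], Upsilon of the torus knot of type
  \<open>(p, p + 1)\<close>: its genus is \<open>p (p - 1) / 2\<close>, and its semigroup has
  \<open>k (k + 1) / 2\<close> elements below \<open>p k\<close>.\<close>

definition twist_upsilon :: "nat \<Rightarrow> real \<Rightarrow> real" where
  "twist_upsilon p t =
     (MAX k\<in>{..<p}. - (real k * (real k + 1)) - t * (real p * (real p - 1) / 2 - real p * real k))"

lemma torus_semigroup_sym: "torus_semigroup p q = torus_semigroup q p"
  by (auto simp: torus_semigroup_def) (metis add.commute)+

lemma torus_upsilon_sym: "torus_upsilon p q = torus_upsilon q p"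
  unfolding torus_upsilon_def torus_genus_def
  by (simp add: torus_semigroup_sym[of p q] mult.commute)

lemma torus_upsilon_one [simp]: "torus_upsilon (Suc 0) q t = 0"
  by (simp add: torus_upsilon_def torus_genus_def)

lemma coprime_add_mult_iff: "coprime p (q + a * p) \<longleftrightarrow> coprime p q" for p q a :: nat
  using gcd_add_mult[of p a q] by (simp add: coprime_iff_gcd_eq_1 add.commute)

section \<open>The conductor of the semigroup\<close>

lemma ex_residue_class:
  fixes p q n :: nat
  assumes "p > 0" "coprime p q"
  obtains b where "b < p" "int p dvd int n - int q * int b"
proof -
  obtain x where x: "[q * x = 1] (mod p)"
    using cong_solve_coprime_nat[of q p] assms by (auto simp: coprime_commute)
  have "[q * (x * n mod p) = q * (x * n)] (mod p)"
    by (simp add: cong_def mod_mult_right_eq)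
  also have "[q * (x * n) = 1 * n] (mod p)"
    using cong_scalar_right[OF x, of n] by (simp add: mult.assoc)
  finally have "[int n = int q * int (x * n mod p)] (mod int p)"
    by (metis cong_int_iff cong_sym mult_1 of_nat_mult)
  then show thesis
    using that[of "x * n mod p"] assms(1) by (simp add: cong_iff_dvd_diff)
qed

text \<open>Write \<open>n = q b + p c\<close> with \<open>b < p\<close>. Then
  \<open>n \<ge> (p - 1) (q - 1)\<close> forces \<open>p c > - p\<close>, hence
  \<open>c \<ge> 0\<close>.\<close>

lemma torus_semigroup_conductor:
  assumes "p > 0" "q > 0" "coprime p q" "2 * torus_genus p q \<le> n"
  shows "n \<in> torus_semigroup p q"
proof -
  obtain b where b: "b < p" "int p dvd int n - int q * int b"
    using ex_residue_class assms by metis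
  then obtain c where c: "int n - int q * int b = int p * c" by auto
  have "int q * int b \<le> int q * (int p - 1)"
    using b(1) by (intro mult_left_mono) auto
  moreover have "(int p - 1) * (int q - 1) \<le> int n"
  proof -
    have "int ((p - 1) * (q - 1)) \<le> int n"
      using assms(4) twice_torus_genus[OF assms(3)] by (simp only: of_nat_le_iff)
    then show ?thesis using assms(1,2) by (simp add: of_nat_diff)
  qed
  ultimately have "int p * c > int p * (-1)"
    using c by (simp add: algebra_simps)
  then have "c \<ge> 0" using assms(1) by (simp only: mult_less_cancel_left) auto
  then have "int n = int (p * nat c + q * b)" using c by simp
  then have "n = p * nat c + q * b" by linarith
  then show ?thesis unfolding torus_semigroup_def by blast
qed

section \<open>Counting semigroup elements by residue class\<close>

lemma int_le_div_iff:
  fixes a x p :: int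
  assumes "p > 0"
  shows "a \<le> x div p \<longleftrightarrow> a * p \<le> x"
proof
  assume "a \<le> x div p"
  then have "a * p \<le> x div p * p" using assms by (intro mult_right_mono) auto
  also have "\<dots> \<le> x" using pos_mod_sign[OF assms, of x] div_mult_mod_eq[of x p] by linarith
  finally show "a * p \<le> x" .
next
  assume "a * p \<le> x"
  then show "a \<le> x div p" using zdiv_mono1[of "a * p" x p] assms by simp
qed

text \<open>By coprimality each element is \<open>p a + q b\<close> for exactly one pair with
  \<open>b < p\<close>; for fixed \<open>b\<close>, those below \<open>m\<close> are given by
  \<open>a < N b\<close>.\<close>

lemma card_torus_semigroup:
  assumes "p > 0" "coprime p q"
  shows "int (card (torus_semigroup p q \<inter> {0..<m})) = semigroup_count p q (int m)"
proof -
  define N where "N b = nat ((int m - int q * int b + int p - 1) div int p)" for b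
  have N: "a < N b \<longleftrightarrow> p * a + q * b < m" for a b
  proof -
    have "a < N b \<longleftrightarrow> int a + 1 \<le> (int m - int q * int b + int p - 1) div int p"
      unfolding N_def by linarith
    also have "\<dots> \<longleftrightarrow> (int a + 1) * int p \<le> int m - int q * int b + int p - 1"
      using assms(1) by (intro int_le_div_iff) simp
    also have "\<dots> \<longleftrightarrow> int (p * a + q * b) < int m"
      by (simp add: algebra_simps) linarith
    finally show ?thesis by (simp only: of_nat_less_iff)
  qed
  have inj: "inj_on (\<lambda>(b, a). p * a + q * b) (SIGMA b:{..<p}. {..<N b})"
  proof (rule inj_onI, clarsimp)
    fix b a b' a' assume b: "b < p" "b' < p" and eq: "p * a + q * b = p * a' + q * b'"
    then have "[q * b = q * b'] (mod p)"
      by (metis cong_def mod_mult_self4)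
    then have "[b = b'] (mod p)"
      using assms(2) by (metis cong_mult_lcancel_nat coprime_commute)
    then have "b = b'" using b by (simp add: cong_def)
    then show "b = b' \<and> a = a'" using eq assms(1) by simp
  qed
  have "torus_semigroup p q \<inter> {0..<m} = (\<lambda>(b, a). p * a + q * b) ` (SIGMA b:{..<p}. {..<N b})"
  proof (intro equalityI subsetI)
    fix x assume "x \<in> torus_semigroup p q \<inter> {0..<m}"
    then obtain a b where x: "x = p * a + q * b" "x < m"
      by (auto simp: torus_semigroup_def)
    \<comment> \<open>Multiples of \<open>p\<close> in the coefficient of \<open>q\<close> are
      carried over to the coefficient of \<open>p\<close>.\<close>
    have "x = p * (a + q * (b div p)) + q * (b mod p)"
    proof -
      have "q * b = q * (p * (b div p)) + q * (b mod p)"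
        by (metis distrib_left mult_div_mod_eq)
      then show ?thesis using x(1) by (simp add: distrib_left mult.left_commute)
    qed
    moreover from this x have "a + q * (b div p) < N (b mod p)" by (simp add: N)
    moreover have "b mod p < p" using assms(1) by simp
    ultimately show "x \<in> (\<lambda>(b, a). p * a + q * b) ` (SIGMA b:{..<p}. {..<N b})"
      by (intro image_eqI[of _ _ "(b mod p, a + q * (b div p))"]) auto
  qed (auto simp: N torus_semigroup_def)
  then have "card (torus_semigroup p q \<inter> {0..<m}) = (\<Sum>b<p. N b)"
    using inj by (simp add: card_image)
  then show ?thesis
    by (simp add: semigroup_count_def N_def max_def)
qed

section \<open>The counting function under a full twist\<close>

lemma semigroup_count_shift:
  assumes "p > 0"
  shows "semigroup_count p (q + p) (m + int p * k) =
    (\<Sum>b<p. max 0 ((m - int q * int b + int p - 1) div int p + (k - int b)))"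
  unfolding semigroup_count_def
proof (intro sum.cong refl arg_cong[of _ _ "max 0"])
  fix b
  have "m + int p * k - int (q + p) * int b + int p - 1 =
      (m - int q * int b + int p - 1) + (k - int b) * int p"
    by (simp add: algebra_simps)
  then show "(m + int p * k - int (q + p) * int b + int p - 1) div int p =
      (m - int q * int b + int p - 1) div int p + (k - int b)"
    using assms by (simp only: div_mult_self1 of_nat_eq_0_iff)
qed

lemma sum_max_0_diff:
  assumes "k < p"
  shows "2 * (\<Sum>b<p. max 0 (int k - int b)) = int k * (int k + 1)"
proof -
  have "(\<Sum>b<p. max 0 (int k - int b)) = (\<Sum>b\<le>k. int k - int b)"
    using assms by (intro sum.mono_neutral_cong_right) auto
  also have "2 * \<dots> = int k * (int k + 1)"
  proof -
    have "(\<Sum>b\<le>k. int k - int b) = (\<Sum>b\<le>k. int b)"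
      by (rule sum.reindex_bij_witness[of _ "\<lambda>b. k - b" "\<lambda>b. k - b"]) auto
    moreover have "2 * (\<Sum>b\<le>k. int b) = int k * (int k + 1)"
      by (induction k) (auto simp: algebra_simps)
    ultimately show ?thesis by simp
  qed
  finally show ?thesis .
qed

text \<open>With \<open>m\<close> unrestricted, maximisers \<open>m\<close> and \<open>k\<close>
  found independently can be combined; this bounds the twisted Upsilon from below.\<close>

lemma semigroup_count_twist_le:
  assumes "k < p"
  shows "2 * semigroup_count p (q + p) (m + int p * int k)
    \<le> 2 * semigroup_count p q m + int k * (int k + 1)"
proof -
  have "semigroup_count p (q + p) (m + int p * int k)
      \<le> (\<Sum>b<p. max 0 ((m - int q * int b + int p - 1) div int p) + max 0 (int k - int b))"
    using assms by (subst semigroup_count_shift) (auto intro!: sum_mono)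
  then show ?thesis
    using sum_max_0_diff[OF assms] by (simp add: semigroup_count_def sum.distrib)
qed

text \<open>The bounds on \<open>m\<close> say that \<open>m + p k\<close> lies above
  \<open>(p + q) (k - 1)\<close> and at most at \<open>(p + q) k\<close>; such windows tile the
  integers. They make the quotient nonnegative for \<open>b < k\<close> and nonpositive for
  \<open>b > k\<close>, so no cancellation occurs under \<open>max 0\<close>.\<close>

lemma semigroup_count_twist_eq:
  assumes "k < p" "int q * (int k - 1) - int p < m" "m \<le> int q * int k" "q > 0"
  shows "2 * semigroup_count p (q + p) (m + int p * int k)
    = 2 * semigroup_count p q m + int k * (int k + 1)"
proof -
  have "semigroup_count p (q + p) (m + int p * int k)
      = (\<Sum>b<p. max 0 ((m - int q * int b + int p - 1) div int p) + max 0 (int k - int b))"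
  proof (subst semigroup_count_shift, use assms in simp, rule sum.cong[OF refl])
    fix b
    let ?n = "(m - int q * int b + int p - 1) div int p"
    consider "b < k" | "b = k" | "b > k" by linarith
    then show "max 0 (?n + (int k - int b)) = max 0 ?n + max 0 (int k - int b)"
    proof cases
      case 1
      then have "int q * int b \<le> int q * (int k - 1)" by (intro mult_left_mono) auto
      \<comment> \<open>The strict lower bound on \<open>m\<close> absorbs the \<open>- 1\<close> of
        the ceiling.\<close>
      then have "m - int q * int b + int p - 1 \<ge> 0" using assms(2) by linarith
      then have "?n \<ge> 0" using assms(1) by (simp add: pos_imp_zdiv_nonneg_iff)
      then show ?thesis using 1 by simp
    next
      case 3
      then have "int q * (int k + 1) \<le> int q * int b" by (intro mult_left_mono) auto
      then have "m - int q * int b + int p - 1 < 1 * int p"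
        using assms by (simp add: algebra_simps)
      then have "?n < 1" using assms(1) int_le_div_iff[of "int p" 1 "m - int q * int b + int p - 1"] by linarith
      then show ?thesis using 3 by simp
    qed simp
  qed
  then show ?thesis
    using sum_max_0_diff[OF assms(1)] by (simp add: semigroup_count_def sum.distrib)
qed

section \<open>Upsilon as a maximum over all integers\<close>

lemma torus_upsilon_eq_Max:
  assumes "p > 0" "coprime p q"
  shows "torus_upsilon p q t = (MAX m\<in>{0..2 * torus_genus p q}.
    - 2 * real_of_int (semigroup_count p q (int m)) - t * (real (torus_genus p q) - real m))"
  unfolding torus_upsilon_def by (simp flip: card_torus_semigroup[OF assms])

text \<open>The maximum may be taken over all integers, which frees the shifts by multiples of \<open>p\<close>
  from range restrictions.\<close>

lemma torus_upsilon_ge: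
  assumes "p > 0" "q > 0" "coprime p q" "0 \<le> t" "t \<le> 2"
  shows "- 2 * real_of_int (semigroup_count p q m)
    - t * (real (torus_genus p q) - real_of_int m) \<le> torus_upsilon p q t"
proof -
  let ?g = "torus_genus p q"
  let ?f = "\<lambda>m. - 2 * real_of_int (semigroup_count p q m) - t * (real ?g - real_of_int m)"
  have in_range: "?f (int n) \<le> torus_upsilon p q t" if "n \<le> 2 * ?g" for n
    using that unfolding torus_upsilon_eq_Max[OF assms(1,3)] by (intro Max_ge) auto
  consider "m < 0" | n where "m = int n" "n \<le> 2 * ?g" | n where "m = int n" "n > 2 * ?g"
    by (metis linorder_not_less nat_0_le)
  then show ?thesis
  proof cases
    case 1
    \<comment> \<open>Left of 0 the count cannot drop below its value at 0, while the linear term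
      has slope \<open>t \<ge> 0\<close>.\<close>
    have "semigroup_count p q 0 = 0"
      using card_torus_semigroup[OF assms(1,3), of 0] by simp
    moreover have "semigroup_count p q m \<ge> 0"
      unfolding semigroup_count_def by (intro sum_nonneg) auto
    moreover have "t * real_of_int m \<le> 0"
      using 1 assms(4) by (simp add: mult_nonneg_nonpos)
    ultimately have "?f m \<le> ?f (int 0)" by (simp add: algebra_simps)
    also have "\<dots> \<le> torus_upsilon p q t" by (rule in_range) simp
    finally show ?thesis .
  next
    case 2
    then show ?thesis using in_range by simp
  next
    case 3
    \<comment> \<open>Past the conductor every integer is counted, so a unit step costs 2 and gains
      only \<open>t \<le> 2\<close>.\<close>
    have "torus_semigroup p q \<inter> {0..<n} = (torus_semigroup p q \<inter> {0..<2 * ?g}) \<union> {2 * ?g..<n}"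
      using 3 torus_semigroup_conductor[OF assms(1-3)] by auto
    then have "card (torus_semigroup p q \<inter> {0..<n})
        = card (torus_semigroup p q \<inter> {0..<2 * ?g}) + card {2 * ?g..<n}"
      by (simp only:) (rule card_Un_disjoint, auto)
    then have "semigroup_count p q (int n) = semigroup_count p q (int (2 * ?g)) + (int n - int (2 * ?g))"
      using 3 unfolding card_torus_semigroup[OF assms(1,3), symmetric] by simp
    moreover have "t * (real n - real (2 * ?g)) \<le> 2 * (real n - real (2 * ?g))"
      using 3 assms(5) by (intro mult_right_mono) auto
    ultimately have "?f (int n) \<le> ?f (int (2 * ?g))" by (simp add: algebra_simps)
    also have "\<dots> \<le> torus_upsilon p q t" by (rule in_range) simp
    finally show ?thesis using 3 by simp
  qed
qed

lemma torus_upsilon_attained: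
  assumes "p > 0" "coprime p q"
  obtains m where "m \<le> 2 * torus_genus p q"
    "torus_upsilon p q t = - 2 * real_of_int (semigroup_count p q (int m))
      - t * (real (torus_genus p q) - real m)"
proof -
  have "torus_upsilon p q t \<in> (\<lambda>m. - 2 * real_of_int (semigroup_count p q (int m))
      - t * (real (torus_genus p q) - real m)) ` {0..2 * torus_genus p q}"
    unfolding torus_upsilon_eq_Max[OF assms] by (intro Max_in) auto
  then show thesis using that by auto
qed

section \<open>The full-twist recursion for Upsilon\<close>

lemma torus_genus_twist:
  assumes "p > 0" "q > 0" "coprime p q"
  shows "real (torus_genus p (q + p)) = real (torus_genus p q) + real p * (real p - 1) / 2"
proof -
  have "coprime p (q + p)" using assms(3) coprime_add_mult_iff[of p q 1] by simp
  then have "2 * torus_genus p (q + p) = (p - 1) * (q + p - 1)"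
    by (rule twice_torus_genus)
  moreover have "2 * torus_genus p q = (p - 1) * (q - 1)"
    by (rule twice_torus_genus) fact
  moreover obtain p' q' where "p = Suc p'" "q = Suc q'"
    using assms by (metis gr0_implies_Suc)
  ultimately have "2 * torus_genus p (q + p) = 2 * torus_genus p q + p * (p - 1)"
    by (simp add: algebra_simps)
  then have "real (2 * torus_genus p (q + p)) = real (2 * torus_genus p q + p * (p - 1))"
    by simp
  then show ?thesis using assms(1) by (simp add: of_nat_diff)
qed

text \<open>For the upper bound a maximiser of the twisted side is split as \<open>m + p k\<close>;
  for the lower bound maximisers of the two summands are joined.\<close>

lemma torus_upsilon_twist:
  assumes "p > 0" "q > 0" "coprime p q" "0 \<le> t" "t \<le> 2"
  shows "torus_upsilon p (q + p) t = torus_upsilon p q t + twist_upsilon p t"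
proof (rule antisym)
  let ?e = "\<lambda>k. - (real k * (real k + 1)) - t * (real p * (real p - 1) / 2 - real p * real k)"
  have cop: "coprime p (q + p)" using assms(3) coprime_add_mult_iff[of p q 1] by simp
  note g = torus_genus_twist[OF assms(1-3)]
  show "torus_upsilon p (q + p) t \<le> torus_upsilon p q t + twist_upsilon p t"
  proof -
    obtain m' where m': "m' \<le> 2 * torus_genus p (q + p)"
      "torus_upsilon p (q + p) t = - 2 * real_of_int (semigroup_count p (q + p) (int m'))
        - t * (real (torus_genus p (q + p)) - real m')"
      using torus_upsilon_attained[OF assms(1) cop] by blast
    \<comment> \<open>The ceiling of \<open>m' / (p + q)\<close>, which selects the window
      containing \<open>m'\<close>.\<close>
    define k where "k = (m' + (p + q) - 1) div (p + q)"
    have k_ge: "m' \<le> (p + q) * k" and k_le: "(p + q) * k < m' + (p + q)"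
    proof -
      have "k * (p + q) \<le> m' + (p + q) - 1" unfolding k_def by simp
      then show "(p + q) * k < m' + (p + q)" using assms(1) by (simp add: mult.commute)
      have "(m' + (p + q) - 1) mod (p + q) < p + q" using assms(1) by simp
      then show "m' \<le> (p + q) * k"
        using mult_div_mod_eq[of "p + q" "m' + (p + q) - 1"] unfolding k_def by linarith
    qed
    have "k < p"
    proof -
      have "m' \<le> (p - 1) * (q + p - 1)"
        using m'(1) twice_torus_genus[OF cop] by simp
      also have "\<dots> \<le> (p - 1) * (p + q)" by (intro mult_left_mono) auto
      finally have "(p + q) * k < (p + q) * (p - 1 + 1)"
        using k_le by (simp add: algebra_simps)
      then show ?thesis using assms(1) by (simp only: mult_less_cancel1) auto
    qed
    \<comment> \<open>This may be negative, which \<open>torus_upsilon_ge\<close> permits.\<close>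
    define m where "m = int m' - int p * int k"
    have m'_eq: "int m' = m + int p * int k" by (simp add: m_def)
    have "int m' \<le> (int p + int q) * int k" "(int p + int q) * int k < int m' + (int p + int q)"
      using k_ge k_le by (simp_all flip: of_nat_add of_nat_mult)
    then have "2 * semigroup_count p (q + p) (m + int p * int k)
        = 2 * semigroup_count p q m + int k * (int k + 1)"
      using \<open>k < p\<close> assms(2)
      by (intro semigroup_count_twist_eq) (auto simp: m_def algebra_simps)
    then have "real_of_int (2 * semigroup_count p (q + p) (int m'))
        = real_of_int (2 * semigroup_count p q m + int k * (int k + 1))"
      unfolding m'_eq by (simp only:)
    then have "torus_upsilon p (q + p) t = (- 2 * real_of_int (semigroup_count p q m)
        - t * (real (torus_genus p q) - real_of_int m)) + ?e k"
      using m'(2) g by (simp add: m_def algebra_simps)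
    also have "\<dots> \<le> torus_upsilon p q t + twist_upsilon p t"
    proof (intro add_mono)
      show "?e k \<le> twist_upsilon p t"
        unfolding twist_upsilon_def using \<open>k < p\<close> by (intro Max_ge) auto
    qed (rule torus_upsilon_ge[OF assms])
    finally show ?thesis .
  qed
  show "torus_upsilon p q t + twist_upsilon p t \<le> torus_upsilon p (q + p) t"
  proof -
    obtain m where m: "torus_upsilon p q t = - 2 * real_of_int (semigroup_count p q (int m))
        - t * (real (torus_genus p q) - real m)"
      using torus_upsilon_attained[OF assms(1,3)] by metis
    have "twist_upsilon p t \<in> ?e ` {..<p}"
      unfolding twist_upsilon_def using assms(1) by (intro Max_in) auto
    then obtain k where k: "k < p" "twist_upsilon p t = ?e k" by auto
    have "real_of_int (2 * semigroup_count p (q + p) (int m + int p * int k))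
        \<le> real_of_int (2 * semigroup_count p q (int m) + int k * (int k + 1))"
      using semigroup_count_twist_le[OF k(1)] by (simp only: of_int_le_iff)
    then have "torus_upsilon p q t + twist_upsilon p t \<le>
      - 2 * real_of_int (semigroup_count p (q + p) (int m + int p * int k))
        - t * (real (torus_genus p (q + p)) - real_of_int (int m + int p * int k))"
      using m k(2) g by (simp add: algebra_simps)
    also have "\<dots> \<le> torus_upsilon p (q + p) t"
      using assms cop by (intro torus_upsilon_ge) auto
    finally show ?thesis .
  qed
qed

section \<open>The integral of the full-twist function\<close>

lemma twist_upsilon_eq:
  assumes "i < p" "2 * real i / real p \<le> t" "t \<le> 2 * real (Suc i) / real p"
  shows "twist_upsilon p t =
    - (real i * (real i + 1)) - t * (real p * (real p - 1) / 2 - real p * real i)"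
  unfolding twist_upsilon_def
proof (intro Max_eqI)
  fix y assume "y \<in> (\<lambda>k. - (real k * (real k + 1))
      - t * (real p * (real p - 1) / 2 - real p * real k)) ` {..<p}"
  then obtain k where y: "y = - (real k * (real k + 1))
      - t * (real p * (real p - 1) / 2 - real p * real k)" by auto
  have t: "2 * real i \<le> t * real p" "t * real p \<le> 2 * (real i + 1)"
    using assms by (simp_all add: field_simps)
  \<comment> \<open>The product is the candidate at \<open>i\<close> minus the candidate at
    \<open>k\<close>. Its second factor changes sign according to whether \<open>i + k + 1\<close>
    exceeds \<open>t p\<close>, whence the breakpoints \<open>2 i / p\<close>.\<close>
  have "0 \<le> (real i - real k) * (t * real p - (real i + real k + 1))"
  proof -
    consider "k < i" | "k = i" | "k > i" by linarith
    then show ?thesis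
    proof cases
      case 1
      then have "real k + 1 \<le> real i" by linarith
      then show ?thesis using t by (intro mult_nonneg_nonneg) auto
    next
      case 3
      then have "real i + 1 \<le> real k" by linarith
      then show ?thesis using t by (intro mult_nonpos_nonpos) auto
    qed simp
  qed
  then show "y \<le> - (real i * (real i + 1)) - t * (real p * (real p - 1) / 2 - real p * real i)"
    unfolding y by (simp add: algebra_simps)
qed (use assms in auto)

lemma has_integral_linear:
  fixes a b c d :: real
  assumes "a \<le> b"
  shows "((\<lambda>t. c - t * d) has_integral (c * b - d * b\<^sup>2 / 2) - (c * a - d * a\<^sup>2 / 2)) {a..b}"
  using assms
  by (intro fundamental_theorem_of_calculus)
    (auto intro!: derivative_eq_intros simp flip: has_real_derivative_iff_has_vector_derivative)

text \<open>A closed form up to each breakpoint lets the induction add one linear piece at a time;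
  \<open>n = p\<close> covers [0,2].\<close>

lemma has_integral_twist_upsilon_partial:
  assumes "n \<le> p" "p > 0"
  shows "(twist_upsilon p has_integral
    real n * (2 * (real n)\<^sup>2 + 1 - 3 * real p * real n) / (3 * real p)) {0..2 * real n / real p}"
  using assms(1)
proof (induction n)
  case 0
  then show ?case using has_integral_refl(2)[of _ "0::real"] by simp
next
  case (Suc n)
  let ?a = "2 * real n / real p" and ?b = "2 * real (Suc n) / real p"
  let ?c = "- (real n * (real n + 1))" and ?d = "real p * (real p - 1) / 2 - real p * real n"
  have ab: "?a \<le> ?b" by (simp add: divide_right_mono)
  have "((\<lambda>t. ?c - t * ?d) has_integral (?c * ?b - ?d * ?b\<^sup>2 / 2) - (?c * ?a - ?d * ?a\<^sup>2 / 2)) {?a..?b}"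
    using ab by (rule has_integral_linear)
  then have piece: "(twist_upsilon p has_integral (?c * ?b - ?d * ?b\<^sup>2 / 2) - (?c * ?a - ?d * ?a\<^sup>2 / 2)) {?a..?b}"
    by (rule has_integral_eq[rotated]) (use Suc.prems in \<open>auto simp: twist_upsilon_eq[of n]\<close>)
  have "(twist_upsilon p has_integral
      real n * (2 * (real n)\<^sup>2 + 1 - 3 * real p * real n) / (3 * real p)
        + ((?c * ?b - ?d * ?b\<^sup>2 / 2) - (?c * ?a - ?d * ?a\<^sup>2 / 2))) {0..?b}"
    using Suc.prems by (intro has_integral_combine[OF _ ab Suc.IH piece]) auto
  also have "real n * (2 * (real n)\<^sup>2 + 1 - 3 * real p * real n) / (3 * real p)
        + ((?c * ?b - ?d * ?b\<^sup>2 / 2) - (?c * ?a - ?d * ?a\<^sup>2 / 2))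
      = real (Suc n) * (2 * (real (Suc n))\<^sup>2 + 1 - 3 * real p * real (Suc n)) / (3 * real p)"
    using assms(2) by (simp add: field_simps power2_eq_square)
  finally show ?case .
qed

lemma has_integral_twist_upsilon:
  assumes "p > 0"
  shows "(twist_upsilon p has_integral - ((real p)\<^sup>2 - 1) / 3) {0..2}"
proof -
  have "real p * (2 * (real p)\<^sup>2 + 1 - 3 * real p * real p) / (3 * real p) = - ((real p)\<^sup>2 - 1) / 3"
    using assms by (simp add: field_simps power2_eq_square)
  with has_integral_twist_upsilon_partial[of p p] assms show ?thesis by simp
qed

section \<open>Descent along the continued fraction\<close>

lemma has_integral_torus_upsilon_twists:
  assumes "p > 0" "q > 0" "coprime p q" "(torus_upsilon p q has_integral v) {0..2}"
  shows "(torus_upsilon p (q + a * p) has_integral v - real a * ((real p)\<^sup>2 - 1) / 3) {0..2}"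
proof (induction a)
  case 0
  then show ?case using assms by simp
next
  case (Suc a)
  have "coprime p (q + a * p)" using assms(3) by (simp add: coprime_add_mult_iff)
  then have eq: "torus_upsilon p (q + a * p) t + twist_upsilon p t = torus_upsilon p (q + Suc a * p) t"
    if "t \<in> {0..2}" for t
    using that assms torus_upsilon_twist[of p "q + a * p" t] by (simp add: algebra_simps)
  have "(torus_upsilon p (q + Suc a * p) has_integral
      v - real a * ((real p)\<^sup>2 - 1) / 3 + - ((real p)\<^sup>2 - 1) / 3) {0..2}"
    by (rule has_integral_eq[OF eq has_integral_add[OF Suc.IH has_integral_twist_upsilon[OF assms(1)]]])
  also have "v - real a * ((real p)\<^sup>2 - 1) / 3 + - ((real p)\<^sup>2 - 1) / 3
      = v - real (Suc a) * ((real p)\<^sup>2 - 1) / 3"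
    by (simp add: field_simps)
  finally show ?case .
qed

lemma cf_expansion_nonneg: "cf_expansion as x \<Longrightarrow> x \<ge> 0"
  by (induction rule: cf_expansion.induct) auto

text \<open>If \<open>q / p = a + 1 / x\<close> and \<open>r = q - a p\<close>, then
  \<open>x = p / r\<close>: the shorter list treats the pair \<open>(r, p)\<close>, symmetry swaps
  it, and \<open>a\<close> twists on \<open>p\<close> strands lead to \<open>(p, q)\<close>. Using
  \<open>has_integral\<close> carries integrability along.\<close>

lemma has_integral_torus_upsilon:
  assumes "cf_expansion as (real q / real p)" "p > 0" "q > 0" "coprime p q"
  shows "(torus_upsilon p q has_integral - (real (p * q) - real (sum_list as)) / 3) {0..2}"
  using assms
proof (induction as "real q / real p" arbitrary: p q rule: cf_expansion.induct)
  case (single a)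
  then have "real q = real (a * p)" by (simp add: field_simps)
  then have q: "q = a * p" by linarith
  \<comment> \<open>Here \<open>p\<close> divides \<open>q\<close>, so coprimality leaves only the
    unknot.\<close>
  with single have "p = 1" by simp
  moreover have "torus_upsilon (Suc 0) q = (\<lambda>t. 0)" by auto
  ultimately show ?case using q by simp
next
  case (step as x a)
  \<comment> \<open>Positivity of \<open>x\<close> yields \<open>r > 0\<close>. With zero terms
    allowed, \<open>r\<close> need not be smaller than \<open>p\<close>, so the induction follows
    the list and not the size of the pair.\<close>
  have "x > 0" using cf_expansion_nonneg[OF step(1)] step(3) by simp
  have "1 / x = (real q - real a * real p) / real p"
    using step by (simp add: field_simps)
  moreover from this \<open>x > 0\<close> have "real q - real a * real p > 0"
    using step by (metis zero_less_divide_1_iff zero_less_divide_iff of_nat_0_less_iff less_asym)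
  then have "real (a * p) < real q" by simp
  then have "a * p < q" by linarith
  then obtain r where r: "q = r + a * p" "r > 0"
    by (metis add.commute less_imp_add_positive)
  ultimately have x: "x = real p / real r"
    using step.prems \<open>x > 0\<close> by (simp add: field_simps)
  have cop: "coprime p r" using step.prems r by (simp add: coprime_add_mult_iff)
  then have "(torus_upsilon r p has_integral - (real (r * p) - real (sum_list as)) / 3) {0..2}"
    using step.prems r by (intro step.hyps(2) x) (auto simp: coprime_commute)
  then have "(torus_upsilon p r has_integral - (real (r * p) - real (sum_list as)) / 3) {0..2}"
    by (simp only: torus_upsilon_sym)
  then have "(torus_upsilon p q has_integral
      - (real (r * p) - real (sum_list as)) / 3 - real a * ((real p)\<^sup>2 - 1) / 3) {0..2}"
    using step.prems(1) r cop unfolding r(1) by (intro has_integral_torus_upsilon_twists)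
  also have "- (real (r * p) - real (sum_list as)) / 3 - real a * ((real p)\<^sup>2 - 1) / 3
      = - (real (p * q) - real (sum_list (a # as))) / 3"
    unfolding r(1) by (simp add: field_simps power2_eq_square)
  finally show ?case .
qed

theorem proposition9:
  fixes p q :: nat and as :: "nat list"
  assumes "p > 0" and "q > 0" and "coprime p q"
    and "cf_expansion as (real q / real p)"
  shows "torus_upsilon_integral p q = - (1 / 3) * (real (p * q) - real (sum_list as))"
  using integral_unique[OF has_integral_torus_upsilon[OF assms(4,1-3)]]
  unfolding torus_upsilon_integral_def by linarith

end
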